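(* Let $\{X_n;f_n^{n+1}\}_{n\in\mathbb{N}}$ be an inverse sequence such that $X_n$ is a regular space for each $n\in\mathbb{N}$. If $X_n$ is discretely generated for each $n\in\mathbb{N}$, then the inverse limit $X_\infty=\varprojlim\{X_n;f_n^{n+1}\}_{n\in\mathbb{N}}$ is also discretely generated.
   Context: An inverse sequence $\{X_n;f_n^{n+1}\}_{n\in\mathbb{N}}$ consists of topological spaces $X_n$ and continuous functions $f_n^{n+1}:X_{n+1}\to X_n$. Its inverse limit is the subspace $X_\infty=\{(x_n)_n\in\prod_n X_n:\ x_n=f_n^{n+1}(x_{n+1})\text{ for all }n\in\mathbb{N}\}$ of the product space $\prod_n X_n$. A topological space $X$ is discretely generated if for every $A\subseteq X$ and every $x\in\overline{A}$ there is $E\subseteq A$ such that $E$ is discrete (in the subspace topology) and $x\in\overline{E}$. *)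

theory Defs
  imports "HOL-Analysis.Analysis"
begin

text \<open>
  The spaces of a sequence are topologies on subsets of one type. This loses no generality,
  since the carriers of countably many spaces embed into a common set (their disjoint union).
  The map \<open>f n\<close> is the bonding map from the space with index \<open>n + 1\<close> to the one with index
  \<open>n\<close>; its values outside the carrier of its domain are irrelevant.
\<close>

definition inverse_sequence :: "(nat \<Rightarrow> 'a topology) \<Rightarrow> (nat \<Rightarrow> 'a \<Rightarrow> 'a) \<Rightarrow> bool" where
  "inverse_sequence X f \<longleftrightarrow> (\<forall>n. continuous_map (X (Suc n)) (X n) (f n))"

definition inverse_limit ::
    "(nat \<Rightarrow> 'a topology) \<Rightarrow> (nat \<Rightarrow> 'a \<Rightarrow> 'a) \<Rightarrow> (nat \<Rightarrow> 'a) topology" where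
  "inverse_limit X f =
     subtopology (product_topology X UNIV)
       {x \<in> topspace (product_topology X UNIV). \<forall>n. x n = f n (x (Suc n))}"

definition discretely_generated :: "'a topology \<Rightarrow> bool" where
  "discretely_generated X \<longleftrightarrow>
     (\<forall>A \<subseteq> topspace X. \<forall>x \<in> X closure_of A.
        \<exists>E \<subseteq> A. subtopology X E = discrete_topology E \<and> x \<in> X closure_of E)"

end

theory Submission
  imports Defs
begin

text \<open>
  Let \<open>x\<close> lie in the closure of \<open>A\<close> in the inverse limit. Discrete generation of the \<open>n\<close>-th space
  gives a discrete subset of the projection of \<open>A\<close> whose closure contains the \<open>n\<close>-th coordinate
  of \<open>x\<close>; choosing one preimage in \<open>A\<close> for each of its points lifts it to a discrete set
  \<open>D n \<subseteq> A\<close> (\<open>discrete_lift_clustering_at_image\<close>). The union of the sets \<open>D n\<close> clusters at \<open>x\<close>, because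
  each neighbourhood of \<open>x\<close> contains a neighbourhood determined by a single coordinate
  (\<open>inverse_limit_neighbourhood_base\<close>). What remains is to make this union discrete.

  Here a dichotomy helps: if \<open>x\<close> is in the closure of some \<open>D n\<close>, that set alone is the required
  one. Otherwise \<open>x\<close> has a neighbourhood whose closure misses \<open>D n\<close>, by regularity, and all later
  sets can be chosen inside it, since the part of \<open>A\<close> in a neighbourhood of \<open>x\<close> still clusters
  at \<open>x\<close>. The sets \<open>D n\<close> then lie in the successive differences of a shrinking sequence of
  neighbourhoods, so they are separated from each other by open sets and their union is discrete
  (\<open>discretely_generated_at_if_projections\<close>).
\<close>

section \<open>Discrete sets\<close>

lemma subtopology_eq_discrete_topology_isolated:
  "subtopology X E = discrete_topology E \<longleftrightarrow>
     E \<subseteq> topspace X \<and> (\<forall>e\<in>E. \<exists>U. openin X U \<and> U \<inter> E = {e})"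
proof -
  have "E \<inter> X derived_set_of E = {} \<longleftrightarrow> (\<forall>e\<in>E. \<exists>U. openin X U \<and> U \<inter> E = {e})"
    if "E \<subseteq> topspace X"
  proof -
    have "e \<notin> X derived_set_of E \<longleftrightarrow> (\<exists>U. openin X U \<and> U \<inter> E = {e})" if "e \<in> E" for e
    proof -
      have "e \<notin> X derived_set_of E \<longleftrightarrow> (\<exists>U. openin X U \<and> e \<in> U \<and> (\<forall>y\<in>E. y \<in> U \<longrightarrow> y = e))"
        using that \<open>E \<subseteq> topspace X\<close> unfolding in_derived_set_of by blast
      also have "\<dots> \<longleftrightarrow> (\<exists>U. openin X U \<and> U \<inter> E = {e})"
        by (intro arg_cong[where f = Ex] ext) (use that in auto)
      finally show ?thesis .
    qed
    then show ?thesis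
      unfolding disjoint_iff Ball_def by simp
  qed
  then show ?thesis
    unfolding subtopology_eq_discrete_topology_eq by (rule conj_cong[OF refl])
qed

text \<open>
  Choosing one point over each point of a discrete subset of the image makes the map injective on
  the chosen set, so that preimages of isolating neighbourhoods isolate the chosen points.
\<close>
lemma discrete_lift_clustering_at_image:
  assumes p: "continuous_map Y Z p" and Z: "discretely_generated Z"
    and A: "A \<subseteq> topspace Y" and x: "x \<in> Y closure_of A"
  obtains D where "D \<subseteq> A" "subtopology Y D = discrete_topology D" "p x \<in> Z closure_of p ` D"
proof -
  have "p ` A \<subseteq> topspace Z"
    using p A by (auto simp: continuous_map_def)
  moreover have "p x \<in> Z closure_of p ` A"
    using continuous_map_image_closure_subset[OF p] x by blast
  ultimately obtain E where E: "E \<subseteq> p ` A" "subtopology Z E = discrete_topology E"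
      "p x \<in> Z closure_of E"
    using Z unfolding discretely_generated_def by meson
  obtain D where D: "D \<subseteq> A" "inj_on p D" "E = p ` D"
    using E(1) subset_image_inj by metis
  have "\<exists>U. openin Y U \<and> U \<inter> D = {d}" if d: "d \<in> D" for d
  proof -
    obtain V where V: "openin Z V" "V \<inter> E = {p d}"
      using E(2) D(3) d unfolding subtopology_eq_discrete_topology_isolated by blast
    have "openin Y {y \<in> topspace Y. p y \<in> V}"
      using openin_continuous_map_preimage[OF p V(1)] .
    moreover have "{y \<in> topspace Y. p y \<in> V} \<inter> D = {d}"
      using V(2) D A d by (auto simp: inj_on_def)
    ultimately show ?thesis by blast
  qed
  then have "subtopology Y D = discrete_topology D"
    using D(1) A unfolding subtopology_eq_discrete_topology_isolated by blast
  then show thesis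
    using that D E(3) by blast
qed

text \<open>
  Each \<open>D n\<close> is contained in \<open>W n\<close> and misses the closure of \<open>W (Suc n)\<close>, so the difference of
  these two sets is an open set containing \<open>D n\<close> and no point of any other \<open>D m\<close>.
\<close>
lemma discrete_Union_layers:
  fixes W D :: "nat \<Rightarrow> 'a set"
  assumes opn: "\<And>n. openin Y (W n)" and DW: "\<And>n. D n \<subseteq> W n"
    and closure_W: "\<And>n. Y closure_of W (Suc n) \<subseteq> W n - D n"
    and discr: "\<And>n. subtopology Y (D n) = discrete_topology (D n)"
  shows "subtopology Y (\<Union>n. D n) = discrete_topology (\<Union>n. D n)"
proof -
  have sub: "D n \<subseteq> topspace Y" for n
    using discr[of n] by (simp add: subtopology_eq_discrete_topology_isolated)
  have WSuc: "W (Suc n) \<subseteq> Y closure_of W (Suc n)" for n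
    by (simp add: opn closure_of_subset openin_subset)
  have anti: "W n \<subseteq> W m" if "m \<le> n" for m n
  proof (rule lift_Suc_antimono_le[OF _ that])
    show "W (Suc k) \<subseteq> W k" for k
      using WSuc[of k] closure_W[of k] by blast
  qed
  have "\<exists>U. openin Y U \<and> U \<inter> (\<Union>n. D n) = {d}" if d: "d \<in> D n" for n d
  proof -
    obtain G where G: "openin Y G" "G \<inter> D n = {d}"
      using discr[of n] d unfolding subtopology_eq_discrete_topology_isolated by blast
    define U where "U = G \<inter> (W n - Y closure_of W (Suc n))"
    have "openin Y U"
      unfolding U_def using G(1) opn by (simp add: openin_Int openin_diff)
    moreover have "U \<inter> D m \<subseteq> {d}" for m
    proof (cases m n rule: linorder_cases)
      case less
      then have "W n \<subseteq> W (Suc m)"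
        by (intro anti) simp
      then show ?thesis
        unfolding U_def using WSuc[of m] closure_W[of m] by blast
    next
      case equal
      then show ?thesis
        unfolding U_def using G(2) by blast
    next
      case greater
      then have "W m \<subseteq> W (Suc n)"
        by (intro anti) simp
      then show ?thesis
        unfolding U_def using WSuc[of n] DW[of m] by blast
    qed
    moreover have "d \<in> U"
    proof -
      have "d \<in> G" using G(2) by blast
      moreover have "d \<in> W n - Y closure_of W (Suc n)"
        using d DW[of n] closure_W[of n] by blast
      ultimately show ?thesis
        unfolding U_def by (rule IntI)
    qed
    ultimately show ?thesis
      using d by (intro exI[of _ U]) blast
  qed
  then have "\<exists>U. openin Y U \<and> U \<inter> (\<Union>n. D n) = {e}" if "e \<in> (\<Union>n. D n)" for e
    using that by (elim UN_E)
  moreover have "(\<Union>n. D n) \<subseteq> topspace Y"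
    using sub by (rule UN_least)
  ultimately show ?thesis
    unfolding subtopology_eq_discrete_topology_isolated by (intro conjI ballI)
qed

section \<open>Discrete generation from countably many projections\<close>

text \<open>
  If \<open>x\<close> is in the closure of no discrete subset of \<open>A\<close>, then every choice of \<open>D n\<close> leaves room for a
  smaller neighbourhood \<open>W (Suc n)\<close> of \<open>x\<close>, and the resulting union is such a subset after all.
\<close>
lemma discretely_generated_at_if_projections:
  fixes p :: "nat \<Rightarrow> 'a \<Rightarrow> 'b"
  assumes Y: "regular_space Y"
    and p: "\<And>n. continuous_map Y (Z n) (p n)"
    and Z: "\<And>n. discretely_generated (Z n)"
    and base: "\<And>U. openin Y U \<Longrightarrow> x \<in> U \<Longrightarrow>
      \<exists>n V. openin (Z n) V \<and> p n x \<in> V \<and> {y \<in> topspace Y. p n y \<in> V} \<subseteq> U"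
    and A: "A \<subseteq> topspace Y" and x: "x \<in> Y closure_of A"
  shows "\<exists>E\<subseteq>A. subtopology Y E = discrete_topology E \<and> x \<in> Y closure_of E"
proof (rule ccontr)
  assume no_discrete: "\<not> ?thesis"
  have xY: "x \<in> topspace Y"
    using x by (simp add: in_closure_of)
  \<comment> \<open>The state of the recursion: a neighbourhood of \<open>x\<close> paired with the discrete set chosen inside it.\<close>
  define good where "good n WD \<longleftrightarrow> openin Y (fst WD) \<and> x \<in> fst WD \<and> snd WD \<subseteq> A \<inter> fst WD \<and>
      subtopology Y (snd WD) = discrete_topology (snd WD) \<and>
      p n x \<in> Z n closure_of (p n ` snd WD)" for n WD
  have ex_good: "\<exists>D. good n (W, D)" if W: "openin Y W" "x \<in> W" for n W
  proof -
    have "A \<inter> W \<subseteq> topspace Y"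
      using A by blast
    moreover have "x \<in> Y closure_of (A \<inter> W)"
      using openin_Int_closure_of_subset[OF W(1), of A] x W(2) by (auto simp: Int_commute)
    ultimately obtain D where "D \<subseteq> A \<inter> W" "subtopology Y D = discrete_topology D"
        "p n x \<in> Z n closure_of p n ` D"
      by (rule discrete_lift_clustering_at_image[OF p Z])
    then show ?thesis
      using W unfolding good_def by auto
  qed
  have "\<exists>WD'. good (Suc n) WD' \<and> Y closure_of fst WD' \<subseteq> fst WD - snd WD"
    if "good n WD" for n WD
  proof -
    obtain W D where WD: "WD = (W, D)" by (cases WD)
    have g: "openin Y W" "x \<in> W" "D \<subseteq> A" "subtopology Y D = discrete_topology D"
      using that by (auto simp: good_def WD)
    \<comment> \<open>Since \<open>D\<close> does not cluster at \<open>x\<close>, regularity gives a smaller neighbourhood with closure off \<open>D\<close>.\<close>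
    have "openin Y (W - Y closure_of D)" "x \<in> W - Y closure_of D"
      using g no_discrete by (auto intro: openin_diff)
    then obtain W' C where W': "openin Y W'" "closedin Y C" "x \<in> W'" "W' \<subseteq> C"
        "C \<subseteq> W - Y closure_of D"
      using Y unfolding neighbourhood_base_of_closedin[symmetric] neighbourhood_base_of
      by meson
    have "Y closure_of W' \<subseteq> W - D"
      using closure_of_minimal[OF W'(4,2)] W'(5) closure_of_subset[of D Y] g(3) A by blast
    with ex_good[OF W'(1,3), of "Suc n"] show ?thesis
      by (auto simp: WD)
  qed
  moreover have "\<exists>WD. good 0 WD"
    using ex_good[OF openin_topspace xY] by blast
  ultimately obtain WD where WD: "good n (WD n)"
      "Y closure_of fst (WD (Suc n)) \<subseteq> fst (WD n) - snd (WD n)" for n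
    using dependent_nat_choice[of good "\<lambda>_ WD WD'. Y closure_of fst WD' \<subseteq> fst WD - snd WD"]
    by metis
  let ?E = "\<Union>n. snd (WD n)"
  have "subtopology Y ?E = discrete_topology ?E"
  proof (rule discrete_Union_layers[of Y "\<lambda>n. fst (WD n)"])
    show "Y closure_of fst (WD (Suc n)) \<subseteq> fst (WD n) - snd (WD n)" for n
      by (rule WD(2))
  qed (use WD(1) in \<open>simp_all add: good_def\<close>)
  moreover have "?E \<subseteq> A"
    using WD(1) by (auto simp: good_def)
  moreover have "x \<in> Y closure_of ?E"
    unfolding in_closure_of
  proof (intro conjI allI impI xY)
    fix U assume "x \<in> U \<and> openin Y U"
    then obtain n V where V: "openin (Z n) V" "p n x \<in> V" "{y \<in> topspace Y. p n y \<in> V} \<subseteq> U"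
      using base by blast
    then obtain d where "d \<in> snd (WD n)" "p n d \<in> V"
      using WD(1)[of n] unfolding good_def in_closure_of by blast
    moreover from this have "d \<in> topspace Y"
      using WD(1)[of n] A unfolding good_def by blast
    ultimately show "\<exists>y. y \<in> ?E \<and> y \<in> U"
      using V(3) by blast
  qed
  ultimately show False
    using no_discrete by blast
qed

section \<open>Inverse limits of sequences\<close>

lemma topspace_inverse_limit:
  "topspace (inverse_limit X f) = {x. \<forall>n. x n \<in> topspace (X n) \<and> x n = f n (x (Suc n))}"
proof -
  have "topspace (product_topology X UNIV) = {x. \<forall>n. x n \<in> topspace (X n)}"
    by (auto simp: PiE_UNIV_domain)
  then show ?thesis
    by (simp only: inverse_limit_def topspace_subtopology Int_def mem_Collect_eq
        all_conj_distrib conj_left_absorb)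
qed

lemma inverse_limit_coordinates:
  assumes "y \<in> topspace (inverse_limit X f)"
  shows "y n \<in> topspace (X n)" and "y n = f n (y (Suc n))"
proof -
  have *: "y n \<in> topspace (X n) \<and> y n = f n (y (Suc n))"
    using assms unfolding topspace_inverse_limit mem_Collect_eq by (rule spec)
  show "y n \<in> topspace (X n)"
    using * by (rule conjunct1)
  show "y n = f n (y (Suc n))"
    using * by (rule conjunct2)
qed

text \<open>
  Conditions on the first coordinates are conditions on the last of them, because the bonding maps
  compute each coordinate continuously from the next one.
\<close>
lemma inverse_limit_open_condition_at_last_coordinate:
  assumes f: "inverse_sequence X f" and x: "x \<in> topspace (inverse_limit X f)"
    and U: "\<And>n. openin (X n) (U n)" "\<And>n. x n \<in> U n"
  shows "\<exists>V. openin (X N) V \<and> x N \<in> V \<and>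
    (\<forall>y \<in> topspace (inverse_limit X f). y N \<in> V \<longrightarrow> (\<forall>i\<le>N. y i \<in> U i))"
proof (induction N)
  case 0
  show ?case
    using U by (intro exI[of _ "U 0"]) auto
next
  case (Suc N)
  then obtain V where V: "openin (X N) V" "x N \<in> V"
      "\<And>y i. y \<in> topspace (inverse_limit X f) \<Longrightarrow> y N \<in> V \<Longrightarrow> i \<le> N \<Longrightarrow> y i \<in> U i"
    by blast
  \<comment> \<open>The conditions on earlier coordinates, pulled back along \<open>f N\<close>, together with the new one.\<close>
  let ?V = "{z \<in> topspace (X (Suc N)). f N z \<in> V} \<inter> U (Suc N)"
  have "openin (X (Suc N)) ?V"
    using f V(1) U(1) unfolding inverse_sequence_def
    by (blast intro: openin_Int openin_continuous_map_preimage)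
  moreover have "x (Suc N) \<in> ?V"
    using inverse_limit_coordinates(1)[OF x, of "Suc N"] inverse_limit_coordinates(2)[OF x, of N]
      V(2) U(2) by simp
  moreover have "y i \<in> U i"
    if y: "y \<in> topspace (inverse_limit X f)" "y (Suc N) \<in> ?V" "i \<le> Suc N" for y i
  proof -
    have "y N \<in> V"
      using y(2) inverse_limit_coordinates(2)[OF y(1), of N] by simp
    then show ?thesis
      using V(3)[OF y(1)] y(2,3) by (cases "i = Suc N") auto
  qed
  ultimately show ?case by blast
qed

text \<open>
  A basic open set of the product restricts only finitely many coordinates, hence only coordinates
  up to some \<open>N\<close>, and these restrictions can be transferred to the coordinate \<open>N\<close>.
\<close>
lemma inverse_limit_neighbourhood_base:
  assumes f: "inverse_sequence X f" and G: "openin (inverse_limit X f) G" "x \<in> G"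
  shows "\<exists>n V. openin (X n) V \<and> x n \<in> V \<and> {y \<in> topspace (inverse_limit X f). y n \<in> V} \<subseteq> G"
proof -
  have x: "x \<in> topspace (inverse_limit X f)"
    using G openin_subset by blast
  obtain S where S: "openin (product_topology X UNIV) S"
      "G = S \<inter> topspace (inverse_limit X f)"
    using G(1) unfolding inverse_limit_def openin_subtopology by auto
  then obtain U where U: "finite {i. U i \<noteq> topspace (X i)}" "\<And>i. openin (X i) (U i)"
      "x \<in> Pi\<^sub>E UNIV U" "Pi\<^sub>E UNIV U \<subseteq> S"
    using G(2) unfolding openin_product_topology_alt by auto
  obtain N where N: "\<And>i. U i \<noteq> topspace (X i) \<Longrightarrow> i \<le> N"
    using finite_nat_set_iff_bounded_le[THEN iffD1, OF U(1)] by auto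
  obtain V where V: "openin (X N) V" "x N \<in> V"
      "\<And>y i. y \<in> topspace (inverse_limit X f) \<Longrightarrow> y N \<in> V \<Longrightarrow> i \<le> N \<Longrightarrow> y i \<in> U i"
    using inverse_limit_open_condition_at_last_coordinate[OF f x, of U N] U(2,3) by blast
  have "y \<in> G" if y: "y \<in> topspace (inverse_limit X f)" "y N \<in> V" for y
  proof -
    have "y i \<in> topspace (X i)" for i
      by (rule inverse_limit_coordinates(1)[OF y(1)])
    then have "y i \<in> U i" for i
      using V(3)[OF y] N[of i] by (cases "i \<le> N") auto
    then show ?thesis
      using U(4) S(2) y(1) by (auto simp: PiE_UNIV_domain)
  qed
  then show ?thesis
    using V(1,2) by blast
qed

theorem theorem5p1:
  fixes X :: "nat \<Rightarrow> 'a topology" and f :: "nat \<Rightarrow> 'a \<Rightarrow> 'a"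
  assumes "inverse_sequence X f"
    and "\<And>n. regular_space (X n)"
    and "\<And>n. discretely_generated (X n)"
  shows "discretely_generated (inverse_limit X f)"
proof -
  have regular: "regular_space (inverse_limit X f)"
    unfolding inverse_limit_def
    by (intro regular_space_subtopology) (simp add: regular_space_product_topology assms(2))
  have "continuous_map (inverse_limit X f) (X n) (\<lambda>x. x n)" for n
    unfolding inverse_limit_def
    by (intro continuous_map_from_subtopology continuous_map_product_projection) simp
  then show ?thesis
    unfolding discretely_generated_def
    by (intro allI impI ballI discretely_generated_at_if_projections[OF regular, of X "\<lambda>n x. x n"]
        assms(3) inverse_limit_neighbourhood_base[OF assms(1)])
qed

end
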